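(* Let $\mathcal{F}=(V,\mathcal{A}\cup\mathcal{E})$ be a mixed hypergraph, $\mathcal{D}_{\mathcal{F}}=(V,\mathcal{A}')$ with $\mathcal{A}'=\mathcal{A}\cup\mathcal{A}_{\mathcal{E}}$ its directed extension, $f,g:V\rightarrow\mathbb{Z}_+$ functions and $k\in\mathbb{Z}_+$. Suppose that $$\max\{k-g(v),0\}\leq\min\{k-f(v),d^-_{\mathcal{A}'}(v)\}\quad\text{for all }v\in V,$$ $$\sum_{v\in V}\max\{k-g(v),0\}\leq k(|V|-1)\leq\sum_{v\in V}\min\{k-f(v),d^-_{\mathcal{A}'}(v)\}.$$ Then the dyperedge sets of the $(k,f,g)$-feasible packings in $\mathcal{D}_{\mathcal{F}}$ are exactly the common independent sets of size $k(|V|-1)$ of the matroids $\mathsf{M}^k_{\mathcal{F}}$ and $\mathsf{M}^{(k,f,g)}_{\mathcal{D}_{\mathcal{F}}}$.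
   Context: $\mathbb{Z}_+$ denotes the nonnegative integers. A mixed hypergraph is $\mathcal{F}=(V,\mathcal{A}\cup\mathcal{E})$, where $V$ is a finite nonempty set of vertices, $\mathcal{A}$ is a finite collection of dyperedges and $\mathcal{E}$ is a finite collection of hyperedges (parallel copies are allowed and regarded as distinct elements). A dyperedge is a tuple $a=(tail(a),head(a))$ with $head(a)\in V$ and $tail(a)$ a nonempty subset of $V-\{head(a)\}$; a hyperedge is a subset of $V$ of size at least two. A mixed hypergraph without hyperedges is a directed hypergraph (dypergraph); one without dyperedges is a hypergraph. The underlying hypergraph $\mathcal{H}_{\mathcal{F}}=(V,\mathcal{E}_{\mathcal{A}}\cup\mathcal{E})$ is obtained by replacing every $a\in\mathcal{A}$ by the hyperedge $head(a)\cup tail(a)$. The bundle of $e\in\mathcal{E}$ is $\mathcal{A}_e=\{(e-v,v):v\in e\}$ (bundles of distinct hyperedges are regarded as disjoint from each other and from $\mathcal{A}$). The directed extension of $\mathcal{F}$ is the dypergraph $\mathcal{D}_{\mathcal{F}}=(V,\mathcal{A}\cup\mathcal{A}_{\mathcal{E}})$ with $\mathcal{A}_{\mathcal{E}}=\bigcup_{e\in\mathcal{E}}\mathcal{A}_e$. For a set $\mathcal{Z}$ of dyperedges and $v\in V$, $d^-_{\mathcal{Z}}(v)$ is the number of $a\in\mathcal{Z}$ with $head(a)=v$. An $r$-arborescence is a digraph containing the vertex $r$ whose underlying graph is a tree and in which every vertex except $r$ has exactly one entering arc; it is spanning if its vertex set is $V$. Trimming a dyperedge $a$ means replacing it by an arc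 $uv$ with $v=head(a)$ and $u\in tail(a)$. A spanning $r$-hyperarborescence of a dypergraph on $V$ is a subdypergraph on $V$, together with a root $r\in V$, whose dyperedges can be trimmed (each to one arc) to obtain a spanning $r$-arborescence. A packing of hyperarborescences is a collection of pairwise dyperedge-disjoint hyperarborescences; its dyperedge set is the union of the dyperedge sets of its members. A packing of $k$ spanning hyperarborescences in $\mathcal{D}_{\mathcal{F}}$ is $(k,f,g)$-feasible if every $v\in V$ is the root of at least $f(v)$ and at most $g(v)$ of the $k$ hyperarborescences and, for every $e\in\mathcal{E}$, at most one dyperedge of $\mathcal{A}_e$ is in the dyperedge set of the packing. For a hypergraph $\mathcal{H}=(V,\mathcal{E}_0)$, the hyperforest matroid $\mathsf{M}_{\mathcal{H}}$ is the matroid on $\mathcal{E}_0$ whose independent sets are the $\mathcal{Z}\subseteq\mathcal{E}_0$ with $|V(\mathcal{Z}')|>|\mathcal{Z}'|$ for all $\emptyset\neq\mathcal{Z}'\subseteq\mathcal{Z}$, where $V(\mathcal{Z}')$ is the union of the hyperedges in $\mathcal{Z}'$. The $k$-hyperforest matroid $\mathsf{M}^k_{\mathcal{H}}$ is the matroid on $\mathcal{E}_0$ whose independent sets are those that can be partitioned into $k$ independent sets of $\mathsf{M}_{\mathcal{H}}$ (parts may be empty). The extended $k$-hyperforest matroid $\mathsf{M}^k_{\mathcal{F}}$ on $\mathcal{A}\cup\mathcal{A}_{\mathcal{E}}$ is obtained from $\mathsf{M}^k_{\mathcal{H}_{\mathcal{F}}}$ by replacing every $e\in\mathcal{E}$ by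 $|e|$ parallel copies, identified with the dyperedges in $\mathcal{A}_e$, and identifying each element of $\mathcal{E}_{\mathcal{A}}$ with the corresponding element of $\mathcal{A}$. That is, $\mathcal{Z}$ is independent in $\mathsf{M}^k_{\mathcal{F}}$ iff $|\mathcal{Z}\cap\mathcal{A}_e|\leq1$ for all $e\in\mathcal{E}$ and the corresponding set of hyperedges of $\mathcal{H}_{\mathcal{F}}$ is independent in $\mathsf{M}^k_{\mathcal{H}_{\mathcal{F}}}$. Under the displayed hypotheses, $\mathsf{M}^{(k,f,g)}_{\mathcal{D}_{\mathcal{F}}}$ is the matroid on $\mathcal{A}'$ whose set of bases is $\{\mathcal{Z}\subseteq\mathcal{A}':|\mathcal{Z}|=k(|V|-1),\ f(v)\leq k-d^-_{\mathcal{Z}}(v)\leq g(v)\text{ for all }v\in V\}$. *)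

theory Defs
  imports "Graph_Theory.Digraph_Component" "HOL-Library.Disjoint_Sets"
begin

section \<open>Hypergraphs, dypergraphs and mixed hypergraphs\<close>

text \<open>Dyperedges and hyperedges are identifiers with incidence functions, as arcs are in
  \<^typ>\<open>('v, 'd) pre_digraph\<close>; in this way parallel copies are distinct elements.\<close>

record ('v, 'h) hypergraph =
  hverts :: "'v set"
  hedges :: "'h set"
  hends :: "'h \<Rightarrow> 'v set"

record ('v, 'd) dypergraph =
  dverts :: "'v set"
  darcs :: "'d set"
  dtail :: "'d \<Rightarrow> 'v set"
  dhead :: "'d \<Rightarrow> 'v"

record ('v, 'a, 'e) mixed_hypergraph =
  mverts :: "'v set"
  dyperedges :: "'a set"
  hyperedges :: "'e set"
  mtail :: "'a \<Rightarrow> 'v set"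
  mhead :: "'a \<Rightarrow> 'v"
  mends :: "'e \<Rightarrow> 'v set"

definition wf_hypergraph :: "('v, 'h) hypergraph \<Rightarrow> bool" where
  "wf_hypergraph H \<longleftrightarrow> finite (hverts H) \<and> hverts H \<noteq> {} \<and> finite (hedges H) \<and>
     (\<forall>e \<in> hedges H. hends H e \<subseteq> hverts H \<and> card (hends H e) \<ge> 2)"

definition wf_dypergraph :: "('v, 'd) dypergraph \<Rightarrow> bool" where
  "wf_dypergraph D \<longleftrightarrow> finite (dverts D) \<and> dverts D \<noteq> {} \<and> finite (darcs D) \<and>
     (\<forall>a \<in> darcs D. dhead D a \<in> dverts D \<and> dtail D a \<noteq> {} \<and>
        dtail D a \<subseteq> dverts D - {dhead D a})"

definition wf_mixed_hypergraph :: "('v, 'a, 'e) mixed_hypergraph \<Rightarrow> bool" where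
  "wf_mixed_hypergraph F \<longleftrightarrow> finite (mverts F) \<and> mverts F \<noteq> {} \<and>
     finite (dyperedges F) \<and> finite (hyperedges F) \<and>
     (\<forall>a \<in> dyperedges F. mhead F a \<in> mverts F \<and> mtail F a \<noteq> {} \<and>
        mtail F a \<subseteq> mverts F - {mhead F a}) \<and>
     (\<forall>e \<in> hyperedges F. mends F e \<subseteq> mverts F \<and> card (mends F e) \<ge> 2)"

definition underlying_hypergraph ::
  "('v, 'a, 'e) mixed_hypergraph \<Rightarrow> ('v, 'a + 'e) hypergraph" where
  "underlying_hypergraph F =
     \<lparr>hverts = mverts F,
      hedges = dyperedges F <+> hyperedges F,
      hends = case_sum (\<lambda>a. insert (mhead F a) (mtail F a)) (mends F)\<rparr>"

text \<open>In the directed extension, \<^term>\<open>Inl a\<close> is the original dyperedge \<^term>\<open>a\<close>, and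
  \<^term>\<open>Inr (e, v)\<close> is the dyperedge with tail \<open>e - v\<close> and head \<open>v\<close> in the bundle of the
  hyperedge \<^term>\<open>e\<close>.\<close>

definition hyperedge_bundle :: "('v, 'a, 'e) mixed_hypergraph \<Rightarrow> 'e \<Rightarrow> ('a + 'e \<times> 'v) set" where
  "hyperedge_bundle F e = {Inr (e, v) |v. v \<in> mends F e}"

definition directed_extension ::
  "('v, 'a, 'e) mixed_hypergraph \<Rightarrow> ('v, 'a + 'e \<times> 'v) dypergraph" where
  "directed_extension F =
     \<lparr>dverts = mverts F,
      darcs = Inl ` dyperedges F \<union> (\<Union>e \<in> hyperedges F. hyperedge_bundle F e),
      dtail = case_sum (mtail F) (\<lambda>(e, v). mends F e - {v}),
      dhead = case_sum (mhead F) (\<lambda>(e, v). v)\<rparr>"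

lemma wf_underlying_hypergraph:
  assumes "wf_mixed_hypergraph F"
  shows "wf_hypergraph (underlying_hypergraph F)"
proof -
  have "card (insert (mhead F a) (mtail F a)) \<ge> 2" if "a \<in> dyperedges F" for a
  proof -
    have "finite (mverts F)" and sub: "mtail F a \<noteq> {}" "mtail F a \<subseteq> mverts F - {mhead F a}"
      using assms that by (simp_all add: wf_mixed_hypergraph_def)
    then have t: "mhead F a \<notin> mtail F a" "mtail F a \<noteq> {}" "finite (mtail F a)"
      using finite_subset[OF sub(2)] by auto
    then have "card (mtail F a) > 0" by (simp add: card_gt_0_iff)
    with t show ?thesis by simp
  qed
  with assms show ?thesis
    by (auto simp: wf_mixed_hypergraph_def wf_hypergraph_def underlying_hypergraph_def)
      blast+
qed

lemma wf_directed_extension: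
  assumes "wf_mixed_hypergraph F"
  shows "wf_dypergraph (directed_extension F)"
proof -
  have e: "finite (mends F e)" "mends F e - {v} \<noteq> {}" if "e \<in> hyperedges F" for e v
  proof -
    have e2: "card (mends F e) \<ge> 2" using assms that by (auto simp: wf_mixed_hypergraph_def)
    then show "finite (mends F e)" by (metis card.infinite not_numeral_le_zero)
    show "mends F e - {v} \<noteq> {}"
    proof
      assume "mends F e - {v} = {}"
      then have "card (mends F e) \<le> card {v}" by (intro card_mono) auto
      with e2 show False by simp
    qed
  qed
  then have "finite (hyperedge_bundle F e)" if "e \<in> hyperedges F" for e
    using that by (simp add: hyperedge_bundle_def)
  with assms e(2) show ?thesis
    by (auto simp: wf_mixed_hypergraph_def wf_dypergraph_def directed_extension_def hyperedge_bundle_def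
        simp del: Diff_eq_empty_iff) blast+
qed

definition in_deg :: "('v, 'd) dypergraph \<Rightarrow> 'd set \<Rightarrow> 'v \<Rightarrow> nat" where
  "in_deg D Z v = card {a \<in> Z. dhead D a = v}"


section \<open>Arborescences and packings of hyperarborescences\<close>

text \<open>A cycle \<open>v\<^sub>0, e\<^sub>0, v\<^sub>1, \<dots>, v\<^sub>n\<^sub>-\<^sub>1, e\<^sub>n\<^sub>-\<^sub>1, v\<^sub>0\<close> of the underlying undirected multigraph of
  a digraph: arcs may be traversed in either direction, a loop is a cycle of length one, and
  two (anti)parallel arcs form a cycle of length two. The predicates \<^const>\<open>forest\<close> and
  \<^const>\<open>tree\<close> of the library only exclude directed cycles, so they are not used here; its
  \<^const>\<open>connected\<close> is connectedness of the underlying graph.\<close>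

definition underlying_cycle :: "('v, 'd) pre_digraph \<Rightarrow> 'v list \<Rightarrow> 'd list \<Rightarrow> bool" where
  "underlying_cycle G vs es \<longleftrightarrow>
     es \<noteq> [] \<and> length vs = length es \<and> distinct vs \<and> distinct es \<and> set es \<subseteq> arcs G \<and>
     (\<forall>i < length es. {tail G (es ! i), head G (es ! i)} =
        {vs ! i, vs ! (Suc i mod length es)})"

definition underlying_tree :: "('v, 'd) pre_digraph \<Rightarrow> bool" where
  "underlying_tree G \<longleftrightarrow> connected G \<and> (\<nexists>vs es. underlying_cycle G vs es)"

definition arborescence :: "('v, 'd) pre_digraph \<Rightarrow> 'v \<Rightarrow> bool" where
  "arborescence G r \<longleftrightarrow> wf_digraph G \<and> r \<in> verts G \<and> underlying_tree G \<and>
     (\<forall>v \<in> verts G - {r}. in_degree G v = 1)"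

text \<open>Trimming the dyperedges \<^term>\<open>T\<close> turns each \<^term>\<open>a \<in> T\<close> into an arc from
  \<^term>\<open>t a\<close>, a vertex of its tail, to its head.\<close>

definition trimming :: "('v, 'd) dypergraph \<Rightarrow> 'd set \<Rightarrow> ('d \<Rightarrow> 'v) \<Rightarrow> bool" where
  "trimming D T t \<longleftrightarrow> (\<forall>a \<in> T. t a \<in> dtail D a)"

definition trimmed_digraph ::
  "('v, 'd) dypergraph \<Rightarrow> 'd set \<Rightarrow> ('d \<Rightarrow> 'v) \<Rightarrow> ('v, 'd) pre_digraph" where
  "trimmed_digraph D T t = \<lparr>verts = dverts D, arcs = T, tail = t, head = dhead D\<rparr>"

definition spanning_hyperarborescence ::
  "('v, 'd) dypergraph \<Rightarrow> 'd set \<Rightarrow> 'v \<Rightarrow> bool" where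
  "spanning_hyperarborescence D T r \<longleftrightarrow> T \<subseteq> darcs D \<and>
     (\<exists>t. trimming D T t \<and> arborescence (trimmed_digraph D T t) r)"

text \<open>A packing is a list of pairs (dyperedge set, root). A list rather than a set, because
  members with empty dyperedge set (which occur if there is only one vertex) can be
  repeated.\<close>

definition packing :: "('v, 'd) dypergraph \<Rightarrow> ('d set \<times> 'v) list \<Rightarrow> bool" where
  "packing D P \<longleftrightarrow> (\<forall>(T, r) \<in> set P. spanning_hyperarborescence D T r) \<and>
     disjoint_family_on (\<lambda>i. fst (P ! i)) {..<length P}"

definition packing_dyperedges :: "('d set \<times> 'v) list \<Rightarrow> 'd set" where
  "packing_dyperedges P = (\<Union>(T, r) \<in> set P. T)"

definition num_roots :: "('d set \<times> 'v) list \<Rightarrow> 'v \<Rightarrow> nat" where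
  "num_roots P v = card {i. i < length P \<and> snd (P ! i) = v}"

definition feasible_packing ::
  "('v, 'a, 'e) mixed_hypergraph \<Rightarrow> nat \<Rightarrow> ('v \<Rightarrow> nat) \<Rightarrow> ('v \<Rightarrow> nat) \<Rightarrow>
   (('a + 'e \<times> 'v) set \<times> 'v) list \<Rightarrow> bool" where
  "feasible_packing F k f g P \<longleftrightarrow>
     packing (directed_extension F) P \<and> length P = k \<and>
     (\<forall>v \<in> mverts F. f v \<le> num_roots P v \<and> num_roots P v \<le> g v) \<and>
     (\<forall>e \<in> hyperedges F. card (hyperedge_bundle F e \<inter> packing_dyperedges P) \<le> 1)"


section \<open>The matroids, given by their independent sets\<close>

definition hyperforest_indep :: "('v, 'h) hypergraph \<Rightarrow> 'h set \<Rightarrow> bool" where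
  "hyperforest_indep H Z \<longleftrightarrow> Z \<subseteq> hedges H \<and>
     (\<forall>Z'. Z' \<subseteq> Z \<and> Z' \<noteq> {} \<longrightarrow> card (\<Union>e \<in> Z'. hends H e) > card Z')"

definition k_hyperforest_indep :: "('v, 'h) hypergraph \<Rightarrow> nat \<Rightarrow> 'h set \<Rightarrow> bool" where
  "k_hyperforest_indep H k Z \<longleftrightarrow> Z \<subseteq> hedges H \<and>
     (\<exists>P :: nat \<Rightarrow> 'h set. (\<forall>i < k. hyperforest_indep H (P i)) \<and>
        disjoint_family_on P {..<k} \<and> Z = (\<Union>i < k. P i))"

text \<open>The edge of the underlying hypergraph that corresponds to a dyperedge of the directed
  extension.\<close>

definition underlying_edge :: "'a + 'e \<times> 'v \<Rightarrow> 'a + 'e" where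
  "underlying_edge = map_sum id fst"

definition extended_k_hyperforest_indep ::
  "('v, 'a, 'e) mixed_hypergraph \<Rightarrow> nat \<Rightarrow> ('a + 'e \<times> 'v) set \<Rightarrow> bool" where
  "extended_k_hyperforest_indep F k Z \<longleftrightarrow>
     Z \<subseteq> darcs (directed_extension F) \<and>
     (\<forall>e \<in> hyperedges F. card (Z \<inter> hyperedge_bundle F e) \<le> 1) \<and>
     k_hyperforest_indep (underlying_hypergraph F) k (underlying_edge ` Z)"

definition kfg_base ::
  "('v, 'd) dypergraph \<Rightarrow> nat \<Rightarrow> ('v \<Rightarrow> nat) \<Rightarrow> ('v \<Rightarrow> nat) \<Rightarrow> 'd set \<Rightarrow> bool" where
  "kfg_base D k f g Z \<longleftrightarrow> Z \<subseteq> darcs D \<and> card Z = k * (card (dverts D) - 1) \<and>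
     (\<forall>v \<in> dverts D. int (f v) \<le> int k - int (in_deg D Z v) \<and>
                     int k - int (in_deg D Z v) \<le> int (g v))"

definition kfg_indep ::
  "('v, 'd) dypergraph \<Rightarrow> nat \<Rightarrow> ('v \<Rightarrow> nat) \<Rightarrow> ('v \<Rightarrow> nat) \<Rightarrow> 'd set \<Rightarrow> bool" where
  "kfg_indep D k f g Z \<longleftrightarrow> (\<exists>B. kfg_base D k f g B \<and> Z \<subseteq> B)"

end

(* In-degrees count roots: in a packing of k spanning hyperarborescences, v is the root of exactly
   k - d^-(v) members, and each member is a hyperforest because following trimmed arcs backwards
   from a set closed under predecessors would produce a cycle.

   Conversely, let Z be a common independent set of size k(|V|-1) and take each v as a root
   k - d^-_Z(v) times, which gives k roots. A set X induces at most k(|X|-1) hyperedges of k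
   hyperforests, so at least k - |{i : r_i in X}| dyperedges of Z enter X. This is the cut
   condition of Edmonds' disjoint branchings theorem, whose proof by Lovasz works verbatim for
   dyperedges: a dyperedge is added to a branching as soon as one vertex of its tail is reached,
   which replaces the reduction to digraphs by trimming. The k branchings have k(|V|-1) dyperedges
   together, hence use all of Z. *)

theory Submission
  imports Defs "HOL-Library.Multiset"
begin

section \<open>Cycles from predecessor-closed vertex sets\<close>

text \<open>Following the chosen entering arcs backwards never leaves the finite set
  \<open>W\<close>, so some vertex recurs. A shortest return visits distinct vertices, and the arcs
  \<open>c v\<close> at these vertices form a cycle, traversed against their direction.\<close>

lemma underlying_cycle_if_preds_closed:
  assumes "finite W" "W \<noteq> {}"
    and c: "\<And>v. v \<in> W \<Longrightarrow> c v \<in> arcs G \<and> head G (c v) = v \<and> tail G (c v) \<in> W"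
  shows "\<exists>vs es. underlying_cycle G vs es"
proof -
  define p where "p v = tail G (c v)" for v
  obtain w where w: "w \<in> W" using assms(2) by blast
  have pW: "(p ^^ i) x \<in> W" if "x \<in> W" for i x
    using that c by (induction i) (auto simp: p_def)
  have "\<not> inj_on (\<lambda>i. (p ^^ i) w) UNIV"
    using pW[OF w] \<open>finite W\<close> by (meson finite_subset image_subsetI infinite_UNIV_nat finite_image_iff)
  then obtain i j where ij: "i < j" "(p ^^ i) w = (p ^^ j) w"
    by (metis inj_onI nat_neq_iff)
  define x where "x = (p ^^ i) w"
  have x: "x \<in> W" using pW[OF w] by (simp add: x_def)
  have "(p ^^ (j - i)) x = (p ^^ (j - i + i)) w" unfolding x_def funpow_add by simp
  then have ex: "0 < j - i \<and> (p ^^ (j - i)) x = x" using ij by (simp add: x_def)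
  define n where "n = (LEAST n. 0 < n \<and> (p ^^ n) x = x)"
  have n: "0 < n" "(p ^^ n) x = x"
    using LeastI[of "\<lambda>n. 0 < n \<and> (p ^^ n) x = x", OF ex] by (auto simp: n_def)
  have least: "\<not> (0 < m \<and> (p ^^ m) x = x)" if "m < n" for m
    using not_less_Least[of m] that unfolding n_def by blast
  have neq: "(p ^^ l) x \<noteq> (p ^^ m) x" if "l < m" "m < n" for l m
  proof
    assume eq: "(p ^^ l) x = (p ^^ m) x"
    \<comment> \<open>A repetition at \<open>l < m\<close> could be prolonged by the remaining
      \<open>n - m\<close> steps to \<open>x\<close>, which returns to \<open>x\<close> too
      early.\<close>
    have "(p ^^ (n - m + l)) x = (p ^^ (n - m)) ((p ^^ m) x)"
      by (simp add: funpow_add eq)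
    also have "\<dots> = (p ^^ (n - m + m)) x" unfolding funpow_add by simp
    also have "\<dots> = x" using that n(2) by simp
    finally have "(p ^^ (n - m + l)) x = x" .
    moreover have "n - m + l < n" "0 < n - m + l" using that by auto
    ultimately show False using least[of "n - m + l"] by blast
  qed
  have inj: "inj_on (\<lambda>i. (p ^^ i) x) {..<n}"
    by (rule inj_onI) (metis lessThan_iff nat_neq_iff neq)
  \<comment> \<open>The head of \<open>c v\<close> is \<open>v\<close>, so distinct vertices have
    distinct arcs.\<close>
  have inj_c: "inj_on c W" by (rule inj_onI) (metis c)
  define vs where "vs = map (\<lambda>i. (p ^^ i) x) [0..<n]"
  have "(p ^^ (Suc i mod n)) x = p ((p ^^ i) x)" if "i < n" for i
    using that n(2) by (cases "Suc i = n") auto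
  then have "underlying_cycle G vs (map c vs)"
    unfolding underlying_cycle_def using n(1) inj inj_c c pW[OF x]
    by (auto simp: vs_def distinct_map p_def lessThan_atLeast0 inj_on_def intro!: c)
  then show ?thesis by blast
qed

section \<open>Disjoint branchings with prescribed root sets\<close>

text \<open>The rank \<open>\<rho>\<close> increases along the trimmed arcs; this expresses acyclicity and, together with the
  bijection, reachability from \<open>R\<close>.\<close>

definition spanning_branching ::
  "('d \<Rightarrow> 'v set) \<Rightarrow> ('d \<Rightarrow> 'v) \<Rightarrow> 'v set \<Rightarrow> 'v set \<Rightarrow> 'd set \<Rightarrow> bool" where
  "spanning_branching dt dh V R T \<longleftrightarrow> bij_betw dh T (V - R) \<and>
     (\<exists>t (\<rho> :: 'v \<Rightarrow> nat). \<forall>a \<in> T. t a \<in> dt a \<and> \<rho> (t a) < \<rho> (dh a))"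

text \<open>This undoes one step of the induction for disjoint branchings: the head of
  \<open>a\<close> stops being a root and is reached from \<open>R\<close> through \<open>a\<close>
  instead.\<close>

lemma spanning_branching_insert:
  assumes B: "spanning_branching dt dh V (insert (dh a) R) T"
    and a: "a \<notin> T" "dh a \<in> V - R" "dt a \<inter> R \<noteq> {}"
  shows "spanning_branching dt dh V R (insert a T)"
proof -
  obtain t and \<rho> :: "_ \<Rightarrow> nat" where t: "\<forall>a \<in> T. t a \<in> dt a \<and> \<rho> (t a) < \<rho> (dh a)"
    and bij: "bij_betw dh T (V - insert (dh a) R)"
    using B unfolding spanning_branching_def by blast
  obtain u where u: "u \<in> dt a" "u \<in> R" using a(3) by blast
  have "V - R = insert (dh a) (V - insert (dh a) R)" using a(2) by blast
  moreover have "bij_betw dh (insert a T) (insert (dh a) (V - insert (dh a) R))"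
    using bij a(1) by (simp add: bij_betw_def)
  ultimately have bij': "bij_betw dh (insert a T) (V - R)" by simp
  define t' where "t' = t(a := u)"
  \<comment> \<open>The old ranks need not place \<open>R\<close> below \<open>dh a\<close>.
    Resetting \<open>R\<close> to 0 and raising all other vertices repairs this; the other arcs
    still increase because no head lies in \<open>R\<close>.\<close>
  define \<rho>' where "\<rho>' x = (if x \<in> R then 0 else Suc (\<rho> x))" for x
  have "dh b \<notin> R" if "b \<in> insert a T" for b
    using bij' that by (auto simp: bij_betw_def)
  then have "\<forall>b \<in> insert a T. t' b \<in> dt b \<and> \<rho>' (t' b) < \<rho>' (dh b)"
    using t u a(1) by (auto simp: t'_def \<rho>'_def)
  with bij' show ?thesis unfolding spanning_branching_def by blast
qed

lemma card_Collect_eq_sum: "finite A \<Longrightarrow> card {a \<in> A. P a} = (\<Sum>a\<in>A. if P a then 1 else (0::nat))"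
  by (simp add: sum.If_cases Int_def)

text \<open>The inequality holds for each dyperedge separately: a tail lies in the intersection
  exactly if it lies in both sets, and it lies in the union as soon as it lies in one of
  them.\<close>

lemma entering_submodular:
  assumes "finite A"
  shows "card {a \<in> A. dh a \<in> X \<inter> Y \<and> \<not> dt a \<subseteq> X \<inter> Y} + card {a \<in> A. dh a \<in> X \<union> Y \<and> \<not> dt a \<subseteq> X \<union> Y}
    \<le> card {a \<in> A. dh a \<in> X \<and> \<not> dt a \<subseteq> X} + card {a \<in> A. dh a \<in> Y \<and> \<not> dt a \<subseteq> Y}"
  unfolding card_Collect_eq_sum[OF assms] sum.distrib[symmetric]
proof (rule sum_mono)
  fix a
  have "dt a \<subseteq> X \<longrightarrow> dt a \<subseteq> X \<union> Y" "dt a \<subseteq> Y \<longrightarrow> dt a \<subseteq> X \<union> Y" by blast+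
  then show "(if dh a \<in> X \<inter> Y \<and> \<not> dt a \<subseteq> X \<inter> Y then 1 else 0) + (if dh a \<in> X \<union> Y \<and> \<not> dt a \<subseteq> X \<union> Y then 1 else 0)
    \<le> (if dh a \<in> X \<and> \<not> dt a \<subseteq> X then 1 else 0) + (if dh a \<in> Y \<and> \<not> dt a \<subseteq> Y then 1 else (0::nat))"
    by (cases "dt a \<subseteq> X"; cases "dt a \<subseteq> Y") simp_all
qed

text \<open>The demand side of uncrossing, again term by term: a set misses the union iff it misses
  both sets, and misses the intersection if it misses one. An index meeting both sets but not their
  intersection counts only on the right, hence the strict form.\<close>

lemma disjoint_supermodular:
  assumes "finite I"
  shows "card {i \<in> I. R i \<inter> X = {}} + card {i \<in> I. R i \<inter> Y = {}}
    \<le> card {i \<in> I. R i \<inter> (X \<inter> Y) = {}} + card {i \<in> I. R i \<inter> (X \<union> Y) = {}}" (is ?le)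
    and "i \<in> I \<Longrightarrow> R i \<inter> X \<noteq> {} \<Longrightarrow> R i \<inter> Y \<noteq> {} \<Longrightarrow> R i \<inter> (X \<inter> Y) = {} \<Longrightarrow>
      card {i \<in> I. R i \<inter> X = {}} + card {i \<in> I. R i \<inter> Y = {}}
      < card {i \<in> I. R i \<inter> (X \<inter> Y) = {}} + card {i \<in> I. R i \<inter> (X \<union> Y) = {}}" (is "_ \<Longrightarrow> _ \<Longrightarrow> _ \<Longrightarrow> _ \<Longrightarrow> ?less")
proof -
  have cap: "R j \<inter> (X \<inter> Y) = {}" if "R j \<inter> X = {} \<or> R j \<inter> Y = {}" for j using that by blast
  have cup: "R j \<inter> (X \<union> Y) = {} \<longleftrightarrow> R j \<inter> X = {} \<and> R j \<inter> Y = {}" for j by blast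
  have le: "(if R j \<inter> X = {} then 1 else 0) + (if R j \<inter> Y = {} then 1 else 0)
    \<le> (if R j \<inter> (X \<inter> Y) = {} then 1 else 0) + (if R j \<inter> (X \<union> Y) = {} then 1 else (0::nat))" for j
    using cap[of j] cup[of j] by simp
  show ?le
    unfolding card_Collect_eq_sum[OF assms] sum.distrib[symmetric] by (rule sum_mono) (rule le)
  show ?less if "i \<in> I" "R i \<inter> X \<noteq> {}" "R i \<inter> Y \<noteq> {}" "R i \<inter> (X \<inter> Y) = {}"
    unfolding card_Collect_eq_sum[OF assms] sum.distrib[symmetric]
  proof (rule sum_strict_mono_ex1[OF assms])
    show "\<exists>j\<in>I. (if R j \<inter> X = {} then 1 else 0) + (if R j \<inter> Y = {} then 1 else 0)
      < (if R j \<inter> (X \<inter> Y) = {} then 1 else 0) + (if R j \<inter> (X \<union> Y) = {} then 1 else (0::nat))"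
      using that by (intro bexI[of _ i]) simp_all
  qed (rule ballI, rule le)
qed

text \<open>Induction on the number of unreached vertices, summed over the branchings. General root
  sets \<open>R i\<close> make this possible: a step removes a dyperedge from \<open>A\<close> and
  puts its head into one \<open>R i\<close>.\<close>

lemma disjoint_spanning_branchings:
  assumes "finite V" "finite A" "finite I"
    and "\<And>a. a \<in> A \<Longrightarrow> dh a \<in> V \<and> dt a \<subseteq> V"
    and "\<And>i. i \<in> I \<Longrightarrow> R i \<subseteq> V"
    and "\<And>X. X \<subseteq> V \<Longrightarrow> X \<noteq> {} \<Longrightarrow>
      card {i \<in> I. R i \<inter> X = {}} \<le> card {a \<in> A. dh a \<in> X \<and> \<not> dt a \<subseteq> X}"
  shows "\<exists>T. disjoint_family_on T I \<and>
    (\<forall>i \<in> I. T i \<subseteq> A \<and> spanning_branching dt dh V (R i) (T i))"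
  using assms(2,4-)
proof (induction "\<Sum>i\<in>I. card (V - R i)" arbitrary: A R rule: less_induct)
  case less
  note fin = assms(1,3) less.prems(1)
  note inc = less.prems(2) and RV = less.prems(3) and cut = less.prems(4)
  show ?case
  proof (cases "\<forall>i \<in> I. R i = V")
    case True
    then show ?thesis
      by (intro exI[of _ "\<lambda>_. {}"]) (auto simp: disjoint_family_on_def spanning_branching_def bij_betw_def)
  next
    case False
    then obtain i where i: "i \<in> I" "R i \<noteq> V" by blast
    \<comment> \<open>Lovasz: inside a minimal tight set \<open>X\<close> that meets both \<open>R i\<close> and its complement, some dyperedge
      leaves \<open>R i\<close>; by uncrossing it enters no tight set meeting \<open>R i\<close>, so it can be added to the
      \<open>i\<close>-th branching.\<close>
    define tight where "tight X \<longleftrightarrow> X \<subseteq> V \<and> R i \<inter> X \<noteq> {} \<and> X - R i \<noteq> {} \<and>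
      card {i \<in> I. R i \<inter> X = {}} = card {a \<in> A. dh a \<in> X \<and> \<not> dt a \<subseteq> X}" for X
    have V: "V \<noteq> {}" "V - R i \<noteq> {}" using i RV by auto
    \<comment> \<open>No dyperedge enters \<open>V\<close>, so the cut condition for
      \<open>V\<close> makes every root set nonempty. Thus \<open>V\<close> is tight and a smallest
      tight set exists.\<close>
    have E: "{a \<in> A. dh a \<in> V \<and> \<not> dt a \<subseteq> V} = {}" using inc by blast
    then have dis: "card {i \<in> I. R i \<inter> V = {}} = 0"
      using cut[OF subset_refl V(1)] by (simp only: card.empty le_zero_eq)
    then have "{i \<in> I. R i \<inter> V = {}} = {}" using fin by simp
    then have "R i \<inter> V \<noteq> {}" using i by blast
    then have "tight V"
      unfolding tight_def using V dis E by (simp only: card.empty) simp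
    then obtain X where X: "tight X" and minX: "\<And>Y. tight Y \<Longrightarrow> card X \<le> card Y"
      using ex_has_least_nat[of tight V card] by blast
    \<comment> \<open>Besides the root sets missing \<open>X\<close>, also \<open>R i\<close> misses
      \<open>X - R i\<close>. As \<open>X\<close> is tight, more dyperedges enter
      \<open>X - R i\<close> than \<open>X\<close>; one that enters only the former has its tail
      inside \<open>X\<close> and meeting \<open>R i\<close>.\<close>
    have "{i' \<in> I. R i' \<inter> X = {}} \<subset> {i' \<in> I. R i' \<inter> (X - R i) = {}}"
      using X i by (auto simp: tight_def)
    then have "card {i \<in> I. R i \<inter> X = {}} < card {i' \<in> I. R i' \<inter> (X - R i) = {}}"
      using fin by (intro psubset_card_mono) auto
    also have "\<dots> \<le> card {a \<in> A. dh a \<in> X - R i \<and> \<not> dt a \<subseteq> X - R i}"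
      using X by (intro cut) (auto simp: tight_def)
    also have "card {i \<in> I. R i \<inter> X = {}} = card {a \<in> A. dh a \<in> X \<and> \<not> dt a \<subseteq> X}"
      using X unfolding tight_def by blast
    finally have "\<not> {a \<in> A. dh a \<in> X - R i \<and> \<not> dt a \<subseteq> X - R i} \<subseteq> {a \<in> A. dh a \<in> X \<and> \<not> dt a \<subseteq> X}"
      using fin by (auto dest!: card_mono[rotated] simp del: Diff_iff)
    then obtain a where a: "a \<in> A" "dh a \<in> X" "dh a \<notin> R i" "dt a \<subseteq> X" "dt a \<inter> R i \<noteq> {}"
      by blast
    have not_tight: "\<not> tight Y" if Y: "dh a \<in> Y" "\<not> dt a \<subseteq> Y" for Y
    proof
      assume tY: "tight Y"
      have YV: "Y \<subseteq> V" "X \<subseteq> V" using tY X by (auto simp: tight_def)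
      have "X \<inter> Y \<subset> X" using a Y by blast
      then have "card (X \<inter> Y) < card X"
        using YV fin by (intro psubset_card_mono) (auto intro: finite_subset)
      with minX have nt: "\<not> tight (X \<inter> Y)" using leD by blast
      have le: "card {i \<in> I. R i \<inter> (X \<inter> Y) = {}} \<le> card {a \<in> A. dh a \<in> X \<inter> Y \<and> \<not> dt a \<subseteq> X \<inter> Y}"
         "card {i \<in> I. R i \<inter> (X \<union> Y) = {}} \<le> card {a \<in> A. dh a \<in> X \<union> Y \<and> \<not> dt a \<subseteq> X \<union> Y}"
        using YV a Y by (intro cut; blast)+
      note sub = entering_submodular[OF fin(3), of dh X Y dt]
      have eq: "card {i \<in> I. R i \<inter> X = {}} = card {a \<in> A. dh a \<in> X \<and> \<not> dt a \<subseteq> X}"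
        "card {i \<in> I. R i \<inter> Y = {}} = card {a \<in> A. dh a \<in> Y \<and> \<not> dt a \<subseteq> Y}"
        using X tY by (auto simp: tight_def)
      \<comment> \<open>The smaller set \<open>X \<inter> Y\<close> contains \<open>dh a\<close>
        outside \<open>R i\<close>, so it fails to be tight in one of two ways. If
        \<open>R i\<close> misses it, supermodularity is strict; otherwise its cut inequality is
        strict. Either contradicts tightness of \<open>X\<close> and \<open>Y\<close>.\<close>
      show False
      proof (cases "R i \<inter> (X \<inter> Y) = {}")
        case True
        have "card {i \<in> I. R i \<inter> X = {}} + card {i \<in> I. R i \<inter> Y = {}}
          < card {i \<in> I. R i \<inter> (X \<inter> Y) = {}} + card {i \<in> I. R i \<inter> (X \<union> Y) = {}}"
          using True X tY i by (intro disjoint_supermodular(2)[OF fin(2)]) (auto simp: tight_def)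
        with le sub eq show False by linarith
      next
        case False
        then have "card {i \<in> I. R i \<inter> (X \<inter> Y) = {}} \<noteq> card {a \<in> A. dh a \<in> X \<inter> Y \<and> \<not> dt a \<subseteq> X \<inter> Y}"
          using nt YV a Y unfolding tight_def by blast
        with le sub eq disjoint_supermodular(1)[OF fin(2), of R X Y] show False by linarith
      qed
    qed
    define R' where "R' = R(i := insert (dh a) (R i))"
    have "\<exists>T. disjoint_family_on T I \<and>
      (\<forall>j \<in> I. T j \<subseteq> A - {a} \<and> spanning_branching dt dh V (R' j) (T j))"
    proof (rule less.hyps)
      have "V - R' i \<subset> V - R i" using a inc by (auto simp: R'_def)
      then show "(\<Sum>j\<in>I. card (V - R' j)) < (\<Sum>j\<in>I. card (V - R j))"
        using fin i by (intro sum_strict_mono_ex1)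
          (auto simp: R'_def intro!: card_mono bexI[of _ i] psubset_card_mono)
      show "finite (A - {a})" using fin by simp
      show "dh b \<in> V \<and> dt b \<subseteq> V" if "b \<in> A - {a}" for b using that inc by blast
      show "R' j \<subseteq> V" if "j \<in> I" for j
        using inc[OF a(1)] RV[OF that] by (auto simp: R'_def)
      show "card {j \<in> I. R' j \<inter> Y = {}} \<le> card {b \<in> A - {a}. dh b \<in> Y \<and> \<not> dt b \<subseteq> Y}"
        if Y: "Y \<subseteq> V" "Y \<noteq> {}" for Y
      proof -
        let ?E = "{b \<in> A. dh b \<in> Y \<and> \<not> dt b \<subseteq> Y}"
        have sub: "{j \<in> I. R' j \<inter> Y = {}} \<subseteq> {j \<in> I. R j \<inter> Y = {}}"
          by (auto simp: R'_def split: if_splits)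
        then have le: "card {j \<in> I. R' j \<inter> Y = {}} \<le> card {j \<in> I. R j \<inter> Y = {}}"
          using fin by (intro card_mono) auto
        have E: "{b \<in> A - {a}. dh b \<in> Y \<and> \<not> dt b \<subseteq> Y} = ?E - {a}" by blast
        \<comment> \<open>The supply drops, by one, only if \<open>a\<close> enters
          \<open>Y\<close>. Then either \<open>R i\<close> misses \<open>Y\<close> and the demand
          drops too, since \<open>dh a\<close> is a new root in \<open>Y\<close>, or
          \<open>R i\<close> meets \<open>Y\<close> and the inequality had slack because
          \<open>Y\<close> is not tight.\<close>
        show ?thesis
        proof (cases "a \<in> ?E")
          case False
          then have "?E - {a} = ?E" by blast
          then show ?thesis using le cut[OF Y] unfolding E by simp
        next
          case True
          then have "card (?E - {a}) = card ?E - 1" by (rule card_Diff_singleton)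
          moreover have "card {j \<in> I. R' j \<inter> Y = {}} < card ?E"
          proof (cases "R i \<inter> Y = {}")
            case True
            with \<open>a \<in> ?E\<close> i have "{j \<in> I. R' j \<inter> Y = {}} \<subset> {j \<in> I. R j \<inter> Y = {}}"
              using sub by (auto simp: R'_def)
            then have "card {j \<in> I. R' j \<inter> Y = {}} < card {j \<in> I. R j \<inter> Y = {}}"
              using fin by (intro psubset_card_mono) auto
            with cut[OF Y] show ?thesis by linarith
          next
            case False
            with \<open>a \<in> ?E\<close> not_tight[of Y] a Y have "card {j \<in> I. R j \<inter> Y = {}} \<noteq> card ?E"
              unfolding tight_def by blast
            with le cut[OF Y] show ?thesis by linarith
          qed
          ultimately show ?thesis unfolding E by linarith
        qed
      qed
    qed
    then obtain T where T: "disjoint_family_on T I" "\<And>j. j \<in> I \<Longrightarrow> T j \<subseteq> A - {a}"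
      "\<And>j. j \<in> I \<Longrightarrow> spanning_branching dt dh V (R' j) (T j)"
      by blast
    have "spanning_branching dt dh V (R i) (insert a (T i))"
      using T(2,3)[OF i(1)] a inc by (intro spanning_branching_insert) (auto simp: R'_def)
    moreover have "spanning_branching dt dh V (R j) (T j)" if "j \<in> I" "j \<noteq> i" for j
      using T(3)[of j] that by (simp add: R'_def)
    moreover have "disjoint_family_on (T(i := insert a (T i))) I"
      using T(1,2) i unfolding disjoint_family_on_def by (simp add: Int_insert_left Int_insert_right) blast
    ultimately show ?thesis
      using T(2) a(1) i(1) by (intro exI[of _ "T(i := insert a (T i))"] conjI ballI) auto
  qed
qed

section \<open>Hyperarborescences, branchings and hyperforests\<close>

text \<open>Every vertex other than \<open>r\<close> has an entering arc from a vertex of smaller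
  rank, so descending in rank ends at \<open>r\<close> and the digraph is connected. A cycle fails
  at its vertex of largest rank, which two of its arcs would have to enter.\<close>

lemma spanning_hyperarborescenceI:
  assumes wf: "wf_dypergraph D" and TD: "T \<subseteq> darcs D" and r: "r \<in> dverts D"
    and B: "spanning_branching (dtail D) (dhead D) (dverts D) {r} T"
  shows "spanning_hyperarborescence D T r"
proof -
  obtain t and \<rho> :: "_ \<Rightarrow> nat" where t: "\<And>a. a \<in> T \<Longrightarrow> t a \<in> dtail D a"
    and \<rho>: "\<And>a. a \<in> T \<Longrightarrow> \<rho> (t a) < \<rho> (dhead D a)"
    and bij: "bij_betw (dhead D) T (dverts D - {r})"
    using B unfolding spanning_branching_def by blast
  define G where "G = trimmed_digraph D T t"
  have G: "verts G = dverts D" "arcs G = T" "tail G = t" "head G = dhead D"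
    by (simp_all add: G_def trimmed_digraph_def)
  have wfG: "wf_digraph G"
    using wf TD t by unfold_locales (auto simp: G wf_dypergraph_def)
  interpret wf_digraph G by fact
  interpret S: pair_wf_digraph "mk_symmetric G" ..
  have reach: "r \<rightarrow>\<^sup>*\<^bsub>G\<^esub> v" if "v \<in> dverts D" for v
    using that
  proof (induction "\<rho> v" arbitrary: v rule: less_induct)
    case less
    show ?case
    proof (cases "v = r")
      case True
      then show ?thesis using r by (simp add: G)
    next
      case False
      then have "v \<in> dhead D ` T" using bij less.prems by (simp add: bij_betw_def)
      then obtain a where a: "a \<in> T" "dhead D a = v" by blast
      then have "t a \<in> dverts D" using wf TD t[of a] by (auto simp: wf_dypergraph_def)
      then have "r \<rightarrow>\<^sup>*\<^bsub>G\<^esub> t a" using less.hyps \<rho> a by blast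
      moreover have "t a \<rightarrow>\<^bsub>G\<^esub> v"
        using a in_arcs_imp_in_arcs_ends[of a] by (simp add: G)
      ultimately show ?thesis by (rule reachable_adj_trans)
    qed
  qed
  have sreach: "r \<rightarrow>\<^sup>*\<^bsub>mk_symmetric G\<^esub> v" if "v \<in> dverts D" for v
    using reach that by (intro reachable_mk_symmetricI)
  have conn: "connected G"
    unfolding connected_def
  proof (rule strongly_connectedI)
    show "verts (with_proj (mk_symmetric G)) \<noteq> {}" using r by (auto simp: G)
    fix u v assume "u \<in> verts (with_proj (mk_symmetric G))" "v \<in> verts (with_proj (mk_symmetric G))"
    then have "u \<in> dverts D" "v \<in> dverts D" by (auto simp: G)
    then show "u \<rightarrow>\<^sup>*\<^bsub>mk_symmetric G\<^esub> v"
      by (intro S.reachable_trans[OF symmetric_reachable[OF symmetric_mk_symmetric sreach] sreach])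
  qed
  have acyc: "\<not> underlying_cycle G vs es" for vs es
  proof
    assume cyc: "underlying_cycle G vs es"
    define n where "n = length es"
    have n: "0 < n" "length vs = n" and dist: "distinct es" and es: "\<And>i. i < n \<Longrightarrow> es ! i \<in> T"
      and ends: "\<And>i. i < n \<Longrightarrow> {t (es ! i), dhead D (es ! i)} = {vs ! i, vs ! (Suc i mod n)}"
      using cyc by (auto simp: underlying_cycle_def n_def G subset_iff)
    define M where "M = Max (\<rho> ` set vs)"
    have "M \<in> \<rho> ` set vs" unfolding M_def using n by (intro Max_in) auto
    then obtain i where i: "i < n" "\<rho> (vs ! i) = M" using n by (auto simp: in_set_conv_nth)
    have M: "\<rho> (vs ! j) \<le> M" if "j < n" for j
      unfolding M_def using that n by (intro Max_ge) auto
    \<comment> \<open>The cyclic predecessor of \<open>i\<close>, so that \<open>es ! j\<close> and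
      \<open>es ! i\<close> are the cycle arcs at \<open>vs ! i\<close>.\<close>
    define j where "j = (i + (n - 1)) mod n"
    have j: "j < n" using n by (simp add: j_def)
    have Suc_j: "Suc j mod n = i"
    proof -
      have "Suc j mod n = Suc (i + (n - 1)) mod n" by (simp add: j_def mod_Suc_eq)
      also have "Suc (i + (n - 1)) = i + n" using n by simp
      finally show ?thesis using i by simp
    qed
    \<comment> \<open>If the top vertex were the tail of a cycle arc, the head of this arc would
      have larger rank.\<close>
    have top: "dhead D (es ! l) = vs ! i" if "l < n" "vs ! i \<in> {vs ! l, vs ! (Suc l mod n)}" for l
    proof (rule ccontr)
      assume "dhead D (es ! l) \<noteq> vs ! i"
      then have "t (es ! l) = vs ! i" using that(2) ends[OF that(1)] by (auto simp: doubleton_eq_iff)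
      then have "M < \<rho> (dhead D (es ! l))" using \<rho>[OF es[OF that(1)]] i by simp
      moreover have "dhead D (es ! l) \<in> {vs ! l, vs ! (Suc l mod n)}" using ends[OF that(1)] by auto
      then have "\<rho> (dhead D (es ! l)) \<le> M" using M[OF that(1)] M[of "Suc l mod n"] n by auto
      ultimately show False by simp
    qed
    have "dhead D (es ! i) = vs ! i" "dhead D (es ! j) = vs ! i"
      using top i j Suc_j by auto
    \<comment> \<open>Heads are distinct on \<open>T\<close>, so both arcs coincide and the cycle is
      a loop, along which the rank cannot increase.\<close>
    then have "es ! i = es ! j"
      using bij es i j by (auto simp: bij_betw_def inj_on_def)
    then have "i = j" using dist i j by (simp add: nth_eq_iff_index_eq n_def)
    then have "t (es ! i) = dhead D (es ! i)" using ends[of i] Suc_j i by auto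
    then show False using \<rho>[OF es[OF i(1)]] by simp
  qed
  have deg: "in_degree G v = 1" if "v \<in> verts G - {r}" for v
  proof -
    have "v \<in> dhead D ` T" using that bij by (simp add: bij_betw_def G)
    then obtain a where "a \<in> T" "dhead D a = v" by blast
    then have "in_arcs G v = {a}"
      using bij by (auto simp: in_arcs_def G bij_betw_def inj_on_def)
    then show ?thesis by (simp add: in_degree_def)
  qed
  have "arborescence G r"
    using wfG r conn acyc deg by (simp add: arborescence_def underlying_tree_def G)
  then show ?thesis
    using TD t unfolding spanning_hyperarborescence_def trimming_def G_def by blast
qed

text \<open>By acyclicity, every nonempty \<open>T'\<close> has a trimmed tail that is not a head of
  \<open>T'\<close>. The heads of \<open>T'\<close> are \<open>card T'\<close> distinct vertices,
  and this tail is one more, which gives the hyperforest inequality.\<close>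

lemma spanning_hyperarborescenceD:
  assumes wf: "wf_dypergraph D" and T: "spanning_hyperarborescence D T r"
  shows "T \<subseteq> darcs D" "r \<in> dverts D" "bij_betw (dhead D) T (dverts D - {r})"
    and "\<And>T'. T' \<subseteq> T \<Longrightarrow> T' \<noteq> {} \<Longrightarrow> card T' < card (\<Union>a \<in> T'. insert (dhead D a) (dtail D a))"
proof -
  obtain t where t: "\<And>a. a \<in> T \<Longrightarrow> t a \<in> dtail D a"
    and arb: "arborescence (trimmed_digraph D T t) r"
    using T unfolding spanning_hyperarborescence_def trimming_def by blast
  define G where "G = trimmed_digraph D T t"
  have G: "verts G = dverts D" "arcs G = T" "tail G = t" "head G = dhead D"
    by (simp_all add: G_def trimmed_digraph_def)
  show TD: "T \<subseteq> darcs D" using T by (simp add: spanning_hyperarborescence_def)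
  have inD: "dhead D a \<in> dverts D" "dtail D a \<subseteq> dverts D" "t a \<in> dverts D" if "a \<in> T" for a
    using wf TD that t by (fastforce simp: wf_dypergraph_def)+
  have finD: "finite (dverts D)" using wf by (simp add: wf_dypergraph_def)
  show r: "r \<in> dverts D" using arb by (simp add: arborescence_def G_def[symmetric] G)
  have acyc: "\<not> underlying_cycle G vs es" for vs es
    using arb by (auto simp: arborescence_def underlying_tree_def G_def)
  have open_tail: "\<exists>a \<in> T'. t a \<notin> dhead D ` T'" if "T' \<subseteq> T" "T' \<noteq> {}" for T'
  proof (rule ccontr)
    assume "\<not> ?thesis"
    then have cl: "t a \<in> dhead D ` T'" if "a \<in> T'" for a using that by blast
    let ?c = "inv_into T' (dhead D)"
    have "finite (dhead D ` T')" using inD that finD by (intro finite_subset[OF _ finD]) auto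
    then have "\<exists>vs es. underlying_cycle G vs es"
    proof (rule underlying_cycle_if_preds_closed)
      show "dhead D ` T' \<noteq> {}" using that by simp
      show "?c v \<in> arcs G \<and> head G (?c v) = v \<and> tail G (?c v) \<in> dhead D ` T'"
        if "v \<in> dhead D ` T'" for v
        using inv_into_into[OF that] f_inv_into_f[OF that] cl \<open>T' \<subseteq> T\<close> by (simp add: G subset_iff)
    qed
    then show False using acyc by blast
  qed
  have deg: "\<exists>!a. a \<in> T \<and> dhead D a = v" if "v \<in> dverts D - {r}" for v
  proof -
    have "card {b \<in> T. dhead D b = v} = 1"
      using arb that by (auto simp: arborescence_def G_def[symmetric] G in_degree_def in_arcs_def)
    then obtain a where "{b \<in> T. dhead D b = v} = {a}" by (rule card_1_singletonE)
    then show ?thesis by (intro ex1I[of _ a]) (auto simp: set_eq_iff)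
  qed
  \<comment> \<open>\<open>arborescence\<close> leaves the in-degree of \<open>r\<close> open. If an
    arc entered \<open>r\<close>, every vertex would be a head, so no tail could escape the heads of
    \<open>T\<close>.\<close>
  have root: "dhead D a \<noteq> r" if a: "a \<in> T" for a
  proof
    assume "dhead D a = r"
    have "v \<in> dhead D ` T" if "v \<in> dverts D" for v
      using that \<open>dhead D a = r\<close> a deg[of v] by (cases "v = r") auto
    then have "t b \<in> dhead D ` T" if "b \<in> T" for b using inD(3)[OF that] by blast
    moreover have "T \<noteq> {}" using a by blast
    ultimately show False using open_tail[of T] by blast
  qed
  show bij: "bij_betw (dhead D) T (dverts D - {r})"
    unfolding bij_betw_def
  proof
    show "inj_on (dhead D) T"
    proof (rule inj_onI)
      fix a b assume "a \<in> T" "b \<in> T" "dhead D a = dhead D b"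
      moreover from this have "dhead D a \<in> dverts D - {r}" using root inD(1) by simp
      ultimately show "a = b" using deg by metis
    qed
    show "dhead D ` T = dverts D - {r}"
    proof (intro equalityI subsetI)
      show "v \<in> dverts D - {r}" if "v \<in> dhead D ` T" for v
        using that root inD(1) by blast
      show "v \<in> dhead D ` T" if "v \<in> dverts D - {r}" for v
        using deg[OF that] by auto
    qed
  qed
  show "card T' < card (\<Union>a \<in> T'. insert (dhead D a) (dtail D a))" if T': "T' \<subseteq> T" "T' \<noteq> {}" for T'
  proof -
    let ?U = "\<Union>a \<in> T'. insert (dhead D a) (dtail D a)"
    have "?U \<subseteq> dverts D" using inD T' by blast
    then have "finite ?U" using finD finite_subset by blast
    moreover have "dhead D ` T' \<subset> ?U"
    proof
      show "dhead D ` T' \<subseteq> ?U" by blast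
      obtain a where "a \<in> T'" "t a \<notin> dhead D ` T'" using open_tail[OF T'] by blast
      moreover from this have "t a \<in> ?U" using t T'(1) by blast
      ultimately show "dhead D ` T' \<noteq> ?U" by blast
    qed
    ultimately have "card (dhead D ` T') < card ?U" by (intro psubset_card_mono)
    moreover have "card (dhead D ` T') = card T'"
      using bij T' by (intro card_image) (auto simp: bij_betw_def intro: inj_on_subset)
    ultimately show ?thesis by simp
  qed
qed

section \<open>Counting heads and roots in packings\<close>

lemma in_deg_hyperarborescence:
  assumes "wf_dypergraph D" "spanning_hyperarborescence D T r" "v \<in> dverts D"
  shows "in_deg D T v = (if v = r then 0 else 1)"
proof -
  have bij: "bij_betw (dhead D) T (dverts D - {r})"
    by (rule spanning_hyperarborescenceD(3)[OF assms(1,2)])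
  show ?thesis
  proof (cases "v = r")
    case True
    then have "{a \<in> T. dhead D a = v} = {}" using bij by (auto simp: bij_betw_def)
    with True show ?thesis by (simp only: in_deg_def) simp
  next
    case False
    then have "v \<in> dhead D ` T" using bij assms(3) by (simp add: bij_betw_def)
    then obtain a where a: "a \<in> T" "dhead D a = v" by blast
    then have "{b \<in> T. dhead D b = v} = {a}"
      using bij by (auto simp: bij_betw_def inj_on_def)
    with False show ?thesis by (simp add: in_deg_def)
  qed
qed

lemma packing_dyperedges_eq_UN: "packing_dyperedges P = (\<Union>i<length P. fst (P ! i))"
proof -
  have "packing_dyperedges P = (\<Union>p\<in>set P. fst p)"
    by (simp add: packing_dyperedges_def case_prod_beta)
  also have "set P = (!) P ` {..<length P}"
    by (simp only: lessThan_atLeast0 list.set_map[symmetric] set_upt[symmetric] map_nth)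
  finally show ?thesis by simp
qed

lemma packingD:
  assumes "packing D P" "i < length P"
  shows "spanning_hyperarborescence D (fst (P ! i)) (snd (P ! i))"
proof -
  have "P ! i \<in> set P" using assms(2) by simp
  with assms(1) show ?thesis by (auto simp: packing_def case_prod_beta)
qed

lemma packing_finite:
  assumes "wf_dypergraph D" "packing D P" "i < length P"
  shows "finite (fst (P ! i))"
  using spanning_hyperarborescenceD(1)[OF assms(1) packingD[OF assms(2,3)]] assms(1)
  by (auto simp: wf_dypergraph_def intro: finite_subset)

lemma packing_disjoint:
  assumes "packing D P" "a \<in> fst (P ! i)" "a \<in> fst (P ! j)" "i < length P" "j < length P"
  shows "i = j"
proof (rule ccontr)
  assume "i \<noteq> j"
  with assms(1,4,5) have "fst (P ! i) \<inter> fst (P ! j) = {}"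
    by (auto simp only: packing_def disjoint_family_on_def lessThan_iff)
  with assms(2,3) show False by blast
qed

text \<open>Each member either is rooted at \<open>v\<close> or contains exactly one dyperedge with
  head \<open>v\<close>, and the members are disjoint.\<close>

lemma in_deg_packing:
  assumes wf: "wf_dypergraph D" and P: "packing D P" and v: "v \<in> dverts D"
  shows "in_deg D (packing_dyperedges P) v + num_roots P v = length P"
proof -
  have "in_deg D (packing_dyperedges P) v = card (\<Union>i<length P. {a \<in> fst (P ! i). dhead D a = v})"
    unfolding in_deg_def packing_dyperedges_eq_UN by (rule arg_cong[where f = card]) blast
  also have "\<dots> = (\<Sum>i<length P. in_deg D (fst (P ! i)) v)"
    unfolding in_deg_def using packing_finite[OF wf P]
    by (intro card_UN_disjoint) (auto dest: packing_disjoint[OF P])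
  also have "\<dots> = (\<Sum>i<length P. if snd (P ! i) = v then 0 else 1)"
    using in_deg_hyperarborescence[OF wf packingD[OF P] v] by (intro sum.cong) auto
  finally have "in_deg D (packing_dyperedges P) v = (\<Sum>i<length P. if snd (P ! i) = v then 0 else 1)" .
  moreover have "num_roots P v = (\<Sum>i<length P. if snd (P ! i) = v then 1 else 0)"
    using card_Collect_eq_sum[of "{..<length P}" "\<lambda>i. snd (P ! i) = v"] by (simp add: num_roots_def)
  ultimately have "in_deg D (packing_dyperedges P) v + num_roots P v =
    (\<Sum>i<length P. (if snd (P ! i) = v then 0 else 1) + (if snd (P ! i) = v then 1 else 0))"
    by (simp only: sum.distrib)
  also have "\<dots> = (\<Sum>i<length P. 1)" by (intro sum.cong) auto
  finally show ?thesis by simp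
qed

lemma card_packing_dyperedges:
  assumes wf: "wf_dypergraph D" and P: "packing D P"
  shows "card (packing_dyperedges P) = length P * (card (dverts D) - 1)"
proof -
  have "card (packing_dyperedges P) = (\<Sum>i<length P. card (fst (P ! i)))"
    unfolding packing_dyperedges_eq_UN using packing_finite[OF wf P]
    by (intro card_UN_disjoint) (auto dest: packing_disjoint[OF P])
  also have "\<dots> = (\<Sum>i<length P. card (dverts D) - 1)"
  proof (rule sum.cong)
    fix i assume "i \<in> {..<length P}"
    then have "spanning_hyperarborescence D (fst (P ! i)) (snd (P ! i))" using packingD[OF P] by simp
    from spanning_hyperarborescenceD(2,3)[OF wf this]
    show "card (fst (P ! i)) = card (dverts D) - 1"
      by (simp add: bij_betw_same_card)
  qed simp
  finally show ?thesis by simp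
qed

section \<open>Decomposing a dyperedge set into a packing\<close>

lemma sum_in_deg:
  assumes "finite Z" "finite X"
  shows "(\<Sum>v\<in>X. in_deg D Z v) = card {a \<in> Z. dhead D a \<in> X}"
proof -
  have "{a \<in> Z. dhead D a \<in> X} = (\<Union>v\<in>X. {a \<in> Z. dhead D a = v})" by blast
  also have "card \<dots> = (\<Sum>v\<in>X. in_deg D Z v)"
    unfolding in_deg_def using assms by (intro card_UN_disjoint) auto
  finally show ?thesis by simp
qed

lemma list_with_multiplicities:
  assumes "finite V"
  shows "\<exists>xs. set xs \<subseteq> V \<and> (\<forall>v \<in> V. card {i. i < length xs \<and> xs ! i = v} = m v)"
proof -
  obtain xs where xs: "mset xs = (\<Sum>v\<in>V. replicate_mset (m v) v)" using ex_mset by blast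
  have "card {i. i < length xs \<and> xs ! i = v} = m v" if "v \<in> V" for v
  proof -
    have "card {i. i < length xs \<and> xs ! i = v} = count (mset xs) v"
      by (simp add: count_mset count_list_eq_length_filter length_filter_conv_card eq_commute)
    also have "\<dots> = (\<Sum>u\<in>V. if v = u then m u else 0)"
      by (simp add: xs count_sum cong: if_cong)
    finally show ?thesis using that assms by simp
  qed
  moreover have "set xs \<subseteq> V"
    using assms by (simp add: set_mset_mset[symmetric] xs set_mset_sum del: set_mset_mset)
  ultimately show ?thesis by blast
qed

text \<open>The bound on dyperedges inside \<open>X\<close>, together with the root multiplicities
  forced by the in-degrees, yields the cut condition of
  \<open>disjoint_spanning_branchings\<close>.\<close>

lemma packing_exists:
  assumes wf: "wf_dypergraph D" and Z: "Z \<subseteq> darcs D" "card Z = k * (card (dverts D) - 1)"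
    and deg: "\<And>v. v \<in> dverts D \<Longrightarrow> in_deg D Z v \<le> k"
    and inside: "\<And>X. X \<subseteq> dverts D \<Longrightarrow> X \<noteq> {} \<Longrightarrow>
      card {a \<in> Z. insert (dhead D a) (dtail D a) \<subseteq> X} \<le> k * (card X - 1)"
  shows "\<exists>P. packing D P \<and> length P = k \<and> packing_dyperedges P = Z"
proof -
  define V where "V = dverts D"
  have fin: "finite V" "V \<noteq> {}" "finite Z"
    using wf Z(1) by (auto simp: wf_dypergraph_def V_def intro: finite_subset)
  have inc: "dhead D a \<in> V \<and> dtail D a \<subseteq> V" if "a \<in> Z" for a
    using wf Z(1) that by (auto simp: wf_dypergraph_def V_def)
  obtain xs where xs: "set xs \<subseteq> V"
    and mult: "\<And>v. v \<in> V \<Longrightarrow> card {i. i < length xs \<and> xs ! i = v} = k - in_deg D Z v"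
    using list_with_multiplicities[OF fin(1)] by meson
  \<comment> \<open>Each vertex contributes \<open>k\<close> in total, as root or as head;
    \<open>deg\<close> keeps the subtraction from truncating.\<close>
  have roots: "card {i. i < length xs \<and> xs ! i \<in> X} + card {a \<in> Z. dhead D a \<in> X} = k * card X"
    if "X \<subseteq> V" for X
  proof -
    have finX: "finite X" using that fin(1) finite_subset by blast
    have "{i. i < length xs \<and> xs ! i \<in> X} = (\<Union>v\<in>X. {i. i < length xs \<and> xs ! i = v})" by blast
    also have "card \<dots> = (\<Sum>v\<in>X. card {i. i < length xs \<and> xs ! i = v})"
      using finX by (intro card_UN_disjoint) auto
    also have "\<dots> = (\<Sum>v\<in>X. k - in_deg D Z v)"
      using that mult by (intro sum.cong) auto
    finally have "card {i. i < length xs \<and> xs ! i \<in> X} + card {a \<in> Z. dhead D a \<in> X} =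
      (\<Sum>v\<in>X. (k - in_deg D Z v) + in_deg D Z v)"
      using sum_in_deg[OF fin(3) finX, of D] by (simp add: sum.distrib)
    also have "\<dots> = (\<Sum>v\<in>X. k)"
      using that deg by (intro sum.cong) (auto simp: V_def)
    finally show ?thesis by simp
  qed
  have len: "length xs = k"
  proof -
    have "{i. i < length xs \<and> xs ! i \<in> V} = {..<length xs}" using xs by (auto simp: subset_iff)
    moreover have "{a \<in> Z. dhead D a \<in> V} = Z" using inc by blast
    ultimately have "length xs + k * (card V - 1) = k * card V"
      using roots[of V] Z(2) by (simp add: V_def)
    moreover have "k * card V = k * (card V - 1) + k"
      using fin by (cases "card V") auto
    ultimately show ?thesis by simp
  qed
  have "\<exists>T. disjoint_family_on T {..<k} \<and> (\<forall>i \<in> {..<k}. T i \<subseteq> Z \<and>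
    spanning_branching (dtail D) (dhead D) V {xs ! i} (T i))"
  proof (rule disjoint_spanning_branchings)
    show "{xs ! i} \<subseteq> V" if "i \<in> {..<k}" for i using that xs len by (auto simp: subset_iff)
    fix X assume X: "X \<subseteq> V" "X \<noteq> {}"
    have finX: "finite X" using X fin(1) finite_subset by blast
    let ?out = "{i \<in> {..<k}. {xs ! i} \<inter> X = {}}" and ?in = "{i. i < length xs \<and> xs ! i \<in> X}"
    let ?ent = "{a \<in> Z. dhead D a \<in> X \<and> \<not> dtail D a \<subseteq> X}"
    let ?ins = "{a \<in> Z. insert (dhead D a) (dtail D a) \<subseteq> X}"
    have "card (?out \<union> ?in) = card ?out + card ?in" by (intro card_Un_disjoint) auto
    moreover have "?out \<union> ?in = {..<k}" using len by auto
    ultimately have 1: "card ?out + card ?in = k" by simp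
    have "card (?ent \<union> ?ins) = card ?ent + card ?ins" using fin by (intro card_Un_disjoint) auto
    moreover have "?ent \<union> ?ins = {a \<in> Z. dhead D a \<in> X}" by blast
    ultimately have 2: "card ?ent + card ?ins = card {a \<in> Z. dhead D a \<in> X}" by simp
    have 3: "card ?ins \<le> k * (card X - 1)" using X by (intro inside) (auto simp: V_def)
    \<comment> \<open>Of the \<open>k * card X\<close> roots and heads in \<open>X\<close>, at most
      \<open>k * (card X - 1)\<close> are heads of dyperedges inside \<open>X\<close>. So roots in
      \<open>X\<close> and entering dyperedges number at least \<open>k\<close> together.\<close>
    have "k * card X = k * (card X - 1) + k" using X finX by (cases "card X") auto
    with 1 2 3 roots[OF X(1)] show "card ?out \<le> card ?ent" by linarith
  qed (use fin inc in auto)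
  then obtain T where T: "disjoint_family_on T {..<k}" "\<And>i. i < k \<Longrightarrow> T i \<subseteq> Z"
    "\<And>i. i < k \<Longrightarrow> spanning_branching (dtail D) (dhead D) V {xs ! i} (T i)"
    by blast
  define P where "P = map (\<lambda>i. (T i, xs ! i)) [0..<k]"
  have lenP: "length P = k" by (simp add: P_def)
  have "spanning_hyperarborescence D (T i) (xs ! i)" if "i < k" for i
  proof (rule spanning_hyperarborescenceI[OF wf])
    show "T i \<subseteq> darcs D" using T(2)[OF that] Z(1) by blast
    show "xs ! i \<in> dverts D" using xs that len by (auto simp: V_def subset_iff)
    show "spanning_branching (dtail D) (dhead D) (dverts D) {xs ! i} (T i)"
      using T(3)[OF that] by (simp add: V_def)
  qed
  then have P: "packing D P"
    using T(1) by (auto simp: packing_def P_def disjoint_family_on_def)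
  have "packing_dyperedges P \<subseteq> Z"
    by (auto simp: packing_dyperedges_def P_def dest: T(2)[THEN subsetD])
  \<comment> \<open>Equal size shows that the branchings leave no dyperedge of \<open>Z\<close>
    over.\<close>
  moreover have "card (packing_dyperedges P) = card Z"
    using card_packing_dyperedges[OF wf P] Z(2) lenP by simp
  ultimately have "packing_dyperedges P = Z" using fin(3) by (intro card_subset_eq)
  with P lenP show ?thesis by blast
qed

section \<open>Passing to the underlying hypergraph\<close>

lemma hends_underlying_edge:
  assumes "a \<in> darcs (directed_extension F)"
  shows "underlying_edge a \<in> hedges (underlying_hypergraph F)"
    and "hends (underlying_hypergraph F) (underlying_edge a) =
      insert (dhead (directed_extension F) a) (dtail (directed_extension F) a)"
  using assms
  by (auto simp: directed_extension_def underlying_hypergraph_def underlying_edge_def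
      hyperedge_bundle_def)

text \<open>Distinct dyperedges with the same underlying edge lie in one bundle. Injectivity lets
  cardinalities and disjointness pass between dyperedges and hyperedges.\<close>

lemma inj_on_underlying_edge:
  assumes "finite Z" "Z \<subseteq> darcs (directed_extension F)"
    and "\<forall>e \<in> hyperedges F. card (Z \<inter> hyperedge_bundle F e) \<le> 1"
  shows "inj_on underlying_edge Z"
proof (rule inj_onI)
  fix a b assume ab: "a \<in> Z" "b \<in> Z" "underlying_edge a = underlying_edge b"
  show "a = b"
  proof (cases a)
    case (Inl x)
    then show ?thesis using ab by (cases b) (auto simp: underlying_edge_def)
  next
    case (Inr y)
    then obtain e v where a: "a = Inr (e, v)" by (cases y) auto
    then obtain w where b: "b = Inr (e, w)"
      using ab(3) by (cases b) (auto simp: underlying_edge_def)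
    have e: "e \<in> hyperedges F" "a \<in> hyperedge_bundle F e" "b \<in> hyperedge_bundle F e"
      using ab assms(2) by (auto simp: a b directed_extension_def hyperedge_bundle_def)
    then have "card (Z \<inter> hyperedge_bundle F e) \<le> Suc 0" using assms(3) by simp
    with e ab assms(1) show ?thesis by (simp add: card_le_Suc0_iff_eq)
  qed
qed

lemma hyperforest_indep_hyperarborescence:
  assumes "wf_mixed_hypergraph F" and T: "spanning_hyperarborescence (directed_extension F) T r"
    and inj: "inj_on underlying_edge T"
  shows "hyperforest_indep (underlying_hypergraph F) (underlying_edge ` T)"
  unfolding hyperforest_indep_def
proof (intro conjI allI impI)
  note D = spanning_hyperarborescenceD[OF wf_directed_extension[OF assms(1)] T]
  show "underlying_edge ` T \<subseteq> hedges (underlying_hypergraph F)"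
    using D(1) hends_underlying_edge(1) by blast
  fix Z' assume Z': "Z' \<subseteq> underlying_edge ` T \<and> Z' \<noteq> {}"
  then obtain T' where T': "T' \<subseteq> T" "Z' = underlying_edge ` T'" by (meson subset_imageE)
  have "card Z' = card T'" using T' inj by (simp add: card_image inj_on_subset)
  also have "\<dots> < card (\<Union>a \<in> T'. insert (dhead (directed_extension F) a) (dtail (directed_extension F) a))"
    using T' Z' by (intro D(4)) auto
  also have "(\<Union>a \<in> T'. insert (dhead (directed_extension F) a) (dtail (directed_extension F) a)) =
    (\<Union>e \<in> Z'. hends (underlying_hypergraph F) e)"
    using T' D(1) hends_underlying_edge(2) by (force simp: T'(2))
  finally show "card Z' < card (\<Union>e \<in> Z'. hends (underlying_hypergraph F) e)" .
qed

text \<open>In each of the \<open>k\<close> hyperforests, the edges inside \<open>X\<close> span at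
  most \<open>card X\<close> vertices, hence are fewer than that. The hyperforest inequality needs a
  nonempty set, so the empty case is separate.\<close>

lemma k_hyperforest_indep_card_inside:
  assumes "k_hyperforest_indep H k Z" "finite X"
  shows "card {e \<in> Z. hends H e \<subseteq> X} \<le> k * (card X - 1)"
proof -
  obtain P :: "nat \<Rightarrow> _" where P: "\<And>i. i < k \<Longrightarrow> hyperforest_indep H (P i)" and Z: "Z = (\<Union>i<k. P i)"
    using assms(1) unfolding k_hyperforest_indep_def by blast
  have "card {e \<in> P i. hends H e \<subseteq> X} \<le> card X - 1" if "i < k" for i
  proof (cases "{e \<in> P i. hends H e \<subseteq> X} = {}")
    case True
    then show ?thesis by (simp only:) simp
  next
    case False
    then have "card {e \<in> P i. hends H e \<subseteq> X} < card (\<Union>e \<in> {e \<in> P i. hends H e \<subseteq> X}. hends H e)"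
      by (intro P[OF that, unfolded hyperforest_indep_def, THEN conjunct2, rule_format]) blast
    also have "\<dots> \<le> card X" using assms(2) by (intro card_mono) auto
    finally show ?thesis by simp
  qed
  then have "(\<Sum>i<k. card {e \<in> P i. hends H e \<subseteq> X}) \<le> (\<Sum>i<k. card X - 1)"
    by (intro sum_mono) auto
  moreover have "{e \<in> Z. hends H e \<subseteq> X} = (\<Union>i<k. {e \<in> P i. hends H e \<subseteq> X})" by (auto simp: Z)
  then have "card {e \<in> Z. hends H e \<subseteq> X} \<le> (\<Sum>i<k. card {e \<in> P i. hends H e \<subseteq> X})"
    by (simp add: card_UN_le)
  ultimately show ?thesis by simp
qed

section \<open>Feasible packings as common independent sets\<close>

theorem theorem11:
  fixes F :: "('v, 'a, 'e) mixed_hypergraph"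
    and f g :: "'v \<Rightarrow> nat"
    and k :: nat
  assumes "wf_mixed_hypergraph F"
    and "\<forall>v \<in> mverts F.
           max (int k - int (g v)) 0
           \<le> min (int k - int (f v))
                 (int (in_deg (directed_extension F) (darcs (directed_extension F)) v))"
    and "(\<Sum>v \<in> mverts F. max (int k - int (g v)) 0) \<le> int k * (int (card (mverts F)) - 1)"
    and "int k * (int (card (mverts F)) - 1)
         \<le> (\<Sum>v \<in> mverts F. min (int k - int (f v))
               (int (in_deg (directed_extension F) (darcs (directed_extension F)) v)))"
  shows "{packing_dyperedges P |P. feasible_packing F k f g P} =
         {Z. extended_k_hyperforest_indep F k Z \<and> kfg_indep (directed_extension F) k f g Z \<and>
             card Z = k * (card (mverts F) - 1)}"
proof -
  define D where "D = directed_extension F"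
  have wf: "wf_dypergraph D" using wf_directed_extension[OF assms(1)] by (simp add: D_def)
  have V: "dverts D = mverts F" by (simp add: D_def directed_extension_def)
  have finA: "finite (darcs D)" using wf by (simp add: wf_dypergraph_def)
  have "extended_k_hyperforest_indep F k (packing_dyperedges P) \<and>
      kfg_indep D k f g (packing_dyperedges P) \<and>
      card (packing_dyperedges P) = k * (card (mverts F) - 1)"
    if feas: "feasible_packing F k f g P" for P
  proof -
    define Z where "Z = packing_dyperedges P"
    have P: "packing D P" and len: "length P = k"
      and bundle1: "\<forall>e \<in> hyperedges F. card (Z \<inter> hyperedge_bundle F e) \<le> 1"
      and roots: "\<And>v. v \<in> mverts F \<Longrightarrow> f v \<le> num_roots P v \<and> num_roots P v \<le> g v"
      using feas by (auto simp: feasible_packing_def D_def Z_def Int_commute)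
    note arb = packingD[OF P]
    have ZUN: "Z = (\<Union>i<k. fst (P ! i))" by (simp add: Z_def packing_dyperedges_eq_UN len)
    have ZD: "Z \<subseteq> darcs D"
      using spanning_hyperarborescenceD(1)[OF wf arb] by (auto simp: ZUN len)
    have finZ: "finite Z" using ZD finA finite_subset by blast
    have inj: "inj_on underlying_edge Z"
      using inj_on_underlying_edge[OF finZ _ bundle1] ZD by (simp add: D_def)
    have cardZ: "card Z = k * (card (mverts F) - 1)"
      using card_packing_dyperedges[OF wf P] by (simp add: Z_def len V)
    have "kfg_base D k f g Z"
      unfolding kfg_base_def
    proof (intro conjI ballI)
      fix v assume v: "v \<in> dverts D"
      then show "int (f v) \<le> int k - int (in_deg D Z v)" "int k - int (in_deg D Z v) \<le> int (g v)"
        using in_deg_packing[OF wf P v] roots[of v] by (auto simp: V Z_def len)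
    qed (use ZD cardZ V in auto)
    moreover have "k_hyperforest_indep (underlying_hypergraph F) k (underlying_edge ` Z)"
      unfolding k_hyperforest_indep_def
    proof (intro conjI exI[of _ "\<lambda>i. underlying_edge ` fst (P ! i)"] allI impI)
      show "underlying_edge ` Z \<subseteq> hedges (underlying_hypergraph F)"
        using ZD hends_underlying_edge(1) by (auto simp: D_def)
      show "underlying_edge ` Z = (\<Union>i<k. underlying_edge ` fst (P ! i))" by (auto simp: ZUN)
      have sub: "fst (P ! i) \<subseteq> Z" if "i < k" for i using that by (auto simp: ZUN)
      show "hyperforest_indep (underlying_hypergraph F) (underlying_edge ` fst (P ! i))" if "i < k" for i
        using arb that inj_on_subset[OF inj sub[OF that]] len
        by (intro hyperforest_indep_hyperarborescence[OF assms(1)]) (auto simp: D_def)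
      show "disjoint_family_on (\<lambda>i. underlying_edge ` fst (P ! i)) {..<k}"
        using P sub inj_on_image_Int[OF inj]
        by (simp add: packing_def len disjoint_family_on_def flip: inj_on_image_Int[OF inj])
    qed
    ultimately show ?thesis
      using ZD bundle1 cardZ by (auto simp: extended_k_hyperforest_indep_def kfg_indep_def D_def Z_def)
  qed
  moreover have "\<exists>P. Z = packing_dyperedges P \<and> feasible_packing F k f g P"
    if indep: "extended_k_hyperforest_indep F k Z" "kfg_indep D k f g Z"
      and cardZ: "card Z = k * (card (mverts F) - 1)" for Z
  proof -
    obtain B where B: "kfg_base D k f g B" "Z \<subseteq> B" using indep(2) by (auto simp: kfg_indep_def)
    then have "finite B" using finA finite_subset by (auto simp: kfg_base_def)
    \<comment> \<open>All bases have this size, so an independent set of this size is a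
      base.\<close>
    with B cardZ have "Z = B" by (intro card_subset_eq) (auto simp: kfg_base_def V)
    with B have base: "kfg_base D k f g Z" by simp
    then have ZD: "Z \<subseteq> darcs D" by (simp add: kfg_base_def)
    then have finZ: "finite Z" using finA finite_subset by blast
    have bundle1: "\<forall>e \<in> hyperedges F. card (Z \<inter> hyperedge_bundle F e) \<le> 1"
      and forest: "k_hyperforest_indep (underlying_hypergraph F) k (underlying_edge ` Z)"
      using indep(1) by (auto simp: extended_k_hyperforest_indep_def)
    have inj: "inj_on underlying_edge Z"
      using inj_on_underlying_edge[OF finZ _ bundle1] ZD by (simp add: D_def)
    have "\<exists>P. packing D P \<and> length P = k \<and> packing_dyperedges P = Z"
    proof (rule packing_exists[OF wf ZD])
      show "card Z = k * (card (dverts D) - 1)" using cardZ by (simp add: V)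
      \<comment> \<open>Follows from the lower bound \<open>f v\<close> on the difference, since
        \<open>f v\<close> is nonnegative.\<close>
      show "in_deg D Z v \<le> k" if "v \<in> dverts D" for v
        using base that by (force simp: kfg_base_def)
      fix X assume X: "X \<subseteq> dverts D" "X \<noteq> {}"
      have finX: "finite X" using X wf finite_subset by (auto simp: wf_dypergraph_def)
      let ?I = "{a \<in> Z. insert (dhead D a) (dtail D a) \<subseteq> X}"
      have "hends (underlying_hypergraph F) (underlying_edge a) = insert (dhead D a) (dtail D a)"
        if "a \<in> Z" for a
        using that ZD hends_underlying_edge(2)[of a F] by (auto simp: D_def)
      then have "underlying_edge ` ?I = {e \<in> underlying_edge ` Z. hends (underlying_hypergraph F) e \<subseteq> X}"
        by auto
      moreover have "card ?I = card (underlying_edge ` ?I)"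
        by (intro card_image[symmetric] inj_on_subset[OF inj]) auto
      ultimately have "card ?I = card {e \<in> underlying_edge ` Z. hends (underlying_hypergraph F) e \<subseteq> X}"
        by simp
      also have "\<dots> \<le> k * (card X - 1)"
        by (rule k_hyperforest_indep_card_inside[OF forest finX])
      finally show "card ?I \<le> k * (card X - 1)" .
    qed
    then obtain P where P: "packing D P" "length P = k" "packing_dyperedges P = Z" by blast
    \<comment> \<open>The number of roots at \<open>v\<close> is determined by the in-degree in
      \<open>Z\<close>, so the base inequalities become the root bounds for whichever packing was
      obtained.\<close>
    have "f v \<le> num_roots P v \<and> num_roots P v \<le> g v" if v: "v \<in> mverts F" for v
    proof -
      have "int (f v) \<le> int k - int (in_deg D Z v)" "int k - int (in_deg D Z v) \<le> int (g v)"
        using base v by (auto simp: kfg_base_def V)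
      moreover have "in_deg D Z v + num_roots P v = k" using in_deg_packing[OF wf P(1)] v P by (simp add: V)
      ultimately show ?thesis by linarith
    qed
    then have "feasible_packing F k f g P"
      using P bundle1 by (auto simp: feasible_packing_def D_def Int_commute)
    with P(3) show ?thesis by blast
  qed
  ultimately show ?thesis unfolding D_def by blast
qed

end
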